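(* Let $n\ge1$ be a natural number and let $p_0\in(0,1)$. (i) For any natural $m$ with $m\ge np_0+1$ and $n\ge m$, the test $\delta_+(X_{n,p}):=\mathsf I\{X_{n,p}\ge m\}$ of the null hypothesis $H_0\colon p=p_0$ (or $H_0\colon p\le p_0$) versus the right-sided alternative $H_1\colon p>p_0$ is of level $\alpha_+:=\mathsf P(\Pi_{np_0}\ge m)$; that is, $\mathsf E\,\delta_+(X_{n,p})\le\alpha_+$ for all $p\in(0,1)$ with $p\le p_0$. (ii) For any natural $m$ with $m\le np_0-1$, the test $\delta_-(X_{n,p}):=\mathsf I\{X_{n,p}\le m\}$ of the null hypothesis $H_0\colon p=p_0$ (or $H_0\colon p\ge p_0$) versus the left-sided alternative $H_1\colon p<p_0$ is of level $\alpha_-:=\mathsf P(\Pi_{np_0}\le m)$; that is, $\mathsf E\,\delta_-(X_{n,p})\le\alpha_-$ for all $p\in(0,1)$ with $p\ge p_0$. (iii) For any natural $m_1,m_2$ such that $m_1\le np_0\le m_2$ and $n\ge m_2+1$, the test $\delta_\pm(X_{n,p}):=1-\mathsf I\{m_1\le X_{n,p}\le m_2\}$ of the null hypothesis $H_0\colon p=p_0$ versus the two-sided alternative $H_1\colon p\ne p_0$ is of level $\alpha_\pm:=1-\mathsf P(m_1\le\Pi_{np_0}\le m_2)$; that is, $\mathsf E\,\delta_\pm(X_{n,p_0})\le\alpha_\pm$.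
   Context: $X_{n,p}$ denotes a random variable having the binomial distribution with parameters $n$ and $p\in(0,1)$. For real $\lambda>0$, $\Pi_\lambda$ denotes a random variable having the Poisson distribution with parameter $\lambda$. $\mathsf I\{\cdot\}$ denotes the indicator function. Natural numbers are the integers $\ge1$. *)

theory Defs
  imports "HOL-Probability.Probability"
begin

text \<open>
  A test based on an observation of \<open>X\<^sub>n\<^sub>,\<^sub>p \<sim> Bin(n, p)\<close> is a function \<open>\<delta>\<close> of the observed
  value, giving the probability of rejecting the null hypothesis \<open>p \<in> H0\<close>. It is of level \<open>\<alpha>\<close> if
  its probability of rejection \<open>E \<delta>(X\<^sub>n\<^sub>,\<^sub>p)\<close> is at most \<open>\<alpha>\<close> under the null hypothesis. The
  alternative does not enter this notion. The parameter set \<open>H0\<close> is meant to be a subset of the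
  open unit interval, since \<open>binomial_pmf n p\<close> is only specified for \<open>p\<close> in the closed one.
\<close>

definition binomial_test_of_level ::
    "nat \<Rightarrow> real set \<Rightarrow> (nat \<Rightarrow> real) \<Rightarrow> real \<Rightarrow> bool" where
  "binomial_test_of_level n H0 \<delta> \<alpha> \<longleftrightarrow>
     (\<forall>p\<in>H0. measure_pmf.expectation (binomial_pmf n p) \<delta> \<le> \<alpha>)"

definition right_sided_test :: "nat \<Rightarrow> nat \<Rightarrow> real" where
  "right_sided_test m x = indicator {k. k \<ge> m} x"

definition left_sided_test :: "nat \<Rightarrow> nat \<Rightarrow> real" where
  "left_sided_test m x = indicator {k. k \<le> m} x"

definition two_sided_test :: "nat \<Rightarrow> nat \<Rightarrow> nat \<Rightarrow> real" where
  "two_sided_test m1 m2 x = 1 - indicator {k. m1 \<le> k \<and> k \<le> m2} x"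

end

theory Submission
  imports Defs "HOL-Real_Asymp.Real_Asymp"
begin

text \<open>
  Fix the mean \<open>\<mu>\<close> and let \<open>S\<close> be the sum of independent \<open>Bin(n, x)\<close> and Bernoulli(\<open>\<epsilon>\<close>) variables with
  \<open>x = (\<mu> - \<epsilon>) / n\<close>. As \<open>\<epsilon>\<close> runs from \<open>0\<close> to \<open>\<mu> / (n + 1)\<close>, the law of \<open>S\<close> passes from \<open>Bin(n, \<mu>/n)\<close>
  to \<open>Bin(n + 1, \<mu>/(n + 1))\<close>, and the derivative of \<open>P(S \<le> m)\<close> with respect to \<open>\<epsilon>\<close> is
  \<open>(x - \<epsilon>) (b(m) - b(m - 1))\<close>, where \<open>b\<close> is the mass function of \<open>Bin(n - 1, x)\<close>. Its sign is
  determined by whether \<open>m\<close> lies above or below \<open>n x = \<mu> - \<epsilon>\<close>. Hence the distribution function at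
  \<open>m\<close> decreases to its Poisson limit if \<open>m \<ge> \<mu>\<close> and increases to it if \<open>m \<le> \<mu> - 1\<close>.
\<close>

section \<open>Bernstein polynomials as binomial masses: recurrences and derivatives\<close>

text \<open>Conditioning on the outcome of one of the \<open>Suc n\<close> trials; algebraically
  this is Pascal's rule.\<close>

lemma Bernstein_Suc_Suc:
  "Bernstein (Suc n) (Suc k) x = x * Bernstein n k x + (1 - x) * Bernstein n (Suc k) x"
proof (cases "Suc k \<le> n")
  case True
  then have "n - k = Suc (n - Suc k)" by simp
  then show ?thesis by (simp add: Bernstein_def algebra_simps)
next
  case False
  then show ?thesis by (cases "k = n") (simp_all add: Bernstein_def binomial_eq_0)
qed

text \<open>The ratio of consecutive binomial masses, cleared of denominators so that
  \<open>x = 1\<close> is covered. The difference \<open>real n - real k\<close> is taken in the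
  reals; for \<open>k > n\<close> both sides vanish because the masses do.\<close>

lemma Bernstein_Suc_index:
  "(1 + real k) * (1 - x) * Bernstein n (Suc k) x = (real n - real k) * x * Bernstein n k x"
proof (cases "Suc k \<le> n")
  case True
  then have "n - k = Suc (n - Suc k)" by simp
  then have "(1 + real k) * (1 - x) * Bernstein n (Suc k) x =
      ((1 + real k) * real (n choose Suc k)) * (x * x ^ k * (1 - x) ^ (n - k))"
    by (simp add: Bernstein_def)
  also have "(1 + real k) * real (n choose Suc k) = (real n - real k) * real (n choose k)"
    using True
    by (metis Suc_leD of_nat_Suc of_nat_diff of_nat_mult binomial_absorb_comp binomial_absorption)
  finally show ?thesis
    by (simp add: Bernstein_def)
next
  case False
  then show ?thesis by (cases "k = n") (simp_all add: Bernstein_def binomial_eq_0)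
qed

lemma has_field_derivative_Bernstein_0:
  "((\<lambda>x. Bernstein (Suc n) 0 x) has_real_derivative - (real (Suc n) * Bernstein n 0 x)) (at x)"
  unfolding Bernstein_def
  by (auto intro!: derivative_eq_intros simp del: power_Suc)

text \<open>After the product rule, the two absorption identities for binomial coefficients pull the
  common factor \<open>Suc n\<close> out of both terms.\<close>

lemma has_field_derivative_Bernstein_Suc:
  "((\<lambda>x. Bernstein (Suc n) (Suc k) x) has_real_derivative
     real (Suc n) * (Bernstein n k x - Bernstein n (Suc k) x)) (at x)"
proof -
  have 1: "real (Suc k) * real (Suc n choose Suc k) = real (Suc n) * real (n choose k)"
    using Suc_times_binomial_eq[of n k]
    unfolding of_nat_mult[symmetric] of_nat_eq_iff by (simp only: mult.commute)
  have 2: "real (n - k) * real (Suc n choose Suc k) = real (Suc n) * real (n choose Suc k)"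
    using binomial_absorb_comp[of "Suc n" "Suc k"]
    unfolding of_nat_mult[symmetric] of_nat_eq_iff by (simp only: diff_Suc_Suc diff_Suc_1)
  have "((\<lambda>x. Bernstein (Suc n) (Suc k) x) has_real_derivative
     real (Suc n choose Suc k) * (real (Suc k) * x ^ k) * (1 - x) ^ (n - k)
     - real (Suc n choose Suc k) * x ^ Suc k * (real (n - k) * (1 - x) ^ (n - Suc k))) (at x)"
    unfolding Bernstein_def
    by (auto intro!: derivative_eq_intros simp del: power_Suc binomial_Suc_Suc)
  also have "real (Suc n choose Suc k) * (real (Suc k) * x ^ k) * (1 - x) ^ (n - k)
     - real (Suc n choose Suc k) * x ^ Suc k * (real (n - k) * (1 - x) ^ (n - Suc k))
     = (real (Suc k) * real (Suc n choose Suc k)) * x ^ k * (1 - x) ^ (n - k)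
     - (real (n - k) * real (Suc n choose Suc k)) * x ^ Suc k * (1 - x) ^ (n - Suc k)"
    by (simp only: mult_ac)
  also have "\<dots> = real (Suc n) * (Bernstein n k x - Bernstein n (Suc k) x)"
    unfolding 1 2 Bernstein_def by (simp only: mult_ac right_diff_distrib)
  finally show ?thesis .
qed

section \<open>The binomial distribution function\<close>

text \<open>A polynomial on the whole real line, so it can be differentiated without regard to the
  range of \<open>x\<close>; \<open>prob_binomial_pmf_atMost\<close> ties it to
  \<open>binomial_pmf\<close> on the unit interval.\<close>

definition binomial_cdf :: "nat \<Rightarrow> nat \<Rightarrow> real \<Rightarrow> real" where
  "binomial_cdf n m x = (\<Sum>k\<le>m. Bernstein n k x)"

lemma binomial_cdf_Suc_index: "binomial_cdf n (Suc m) x = binomial_cdf n m x + Bernstein n (Suc m) x"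
  by (simp add: binomial_cdf_def)

text \<open>The derivatives of the single masses telescope.\<close>

lemma has_field_derivative_binomial_cdf:
  "((\<lambda>x. binomial_cdf (Suc n) m x) has_real_derivative - (real (Suc n) * Bernstein n m x)) (at x)"
proof (induction m)
  case 0
  then show ?case using has_field_derivative_Bernstein_0 by (simp add: binomial_cdf_def)
next
  case (Suc m)
  show ?case unfolding binomial_cdf_Suc_index
    by (rule derivative_eq_intros Suc has_field_derivative_Bernstein_Suc)+
       (simp add: algebra_simps)
qed

text \<open>One more trial pushes the count from at most \<open>m\<close> to above \<open>m\<close>
  exactly when the count was \<open>m\<close> and the new trial succeeds.\<close>

lemma binomial_cdf_Suc: "binomial_cdf (Suc n) m x = binomial_cdf n m x - x * Bernstein n m x"
proof (induction m)
  case 0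
  then show ?case by (simp add: binomial_cdf_def Bernstein_def algebra_simps)
next
  case (Suc m)
  then show ?case by (simp add: binomial_cdf_Suc_index Bernstein_Suc_Suc algebra_simps)
qed

lemma binomial_cdf_antimono:
  assumes "0 \<le> x" "x \<le> y" "y \<le> 1"
  shows "binomial_cdf n m y \<le> binomial_cdf n m x"
proof (cases n)
  case 0
  have "Bernstein 0 k x = Bernstein 0 k y" for k
    by (cases k) (simp_all add: Bernstein_def)
  then show ?thesis by (simp add: 0 binomial_cdf_def)
next
  case (Suc N)
  show ?thesis unfolding Suc
  proof (rule DERIV_nonpos_imp_nonincreasing[OF assms(2), where f = "binomial_cdf (Suc N) m"])
    fix t assume t: "x \<le> t" "t \<le> y"
    have "0 \<le> Bernstein N m t" using t assms by (intro Bernstein_nonneg) auto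
    then have "- (real (Suc N) * Bernstein N m t) \<le> 0" by simp
    then show "\<exists>d. (binomial_cdf (Suc N) m has_real_derivative d) (at t) \<and> d \<le> 0"
      using has_field_derivative_binomial_cdf by blast
  qed
qed

section \<open>Unimodality of the binomial masses\<close>

text \<open>The threshold \<open>(n + 1) * x\<close> comes from the mass ratio:
  \<open>(n - k) * x \<le> (k + 1) * (1 - x)\<close> rearranges to
  \<open>(n + 1) * x \<le> k + 1\<close>. Strictness of \<open>x < 1\<close> allows the factor
  \<open>1 - x\<close> to be cancelled.\<close>

lemma Bernstein_Suc_index_le:
  assumes "0 \<le> x" "x < 1" "real (Suc n) * x \<le> real (Suc k)"
  shows "Bernstein n (Suc k) x \<le> Bernstein n k x"
proof -
  have pos: "(1 + real k) * (1 - x) > 0" using assms by simp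
  have "(real n - real k) * x \<le> (1 + real k) * (1 - x)" using assms by (simp add: algebra_simps)
  then have "(real n - real k) * x * Bernstein n k x \<le> (1 + real k) * (1 - x) * Bernstein n k x"
    by (rule mult_right_mono) (use assms in \<open>auto intro: Bernstein_nonneg\<close>)
  then show ?thesis
    unfolding Bernstein_Suc_index[symmetric] using pos by (simp add: mult_le_cancel_left_pos)
qed

lemma Bernstein_Suc_index_ge:
  assumes "0 \<le> x" "x < 1" "real (Suc k) \<le> real (Suc n) * x"
  shows "Bernstein n k x \<le> Bernstein n (Suc k) x"
proof -
  have pos: "(1 + real k) * (1 - x) > 0" using assms by simp
  have "(1 + real k) * (1 - x) \<le> (real n - real k) * x" using assms by (simp add: algebra_simps)
  then have "(1 + real k) * (1 - x) * Bernstein n k x \<le> (real n - real k) * x * Bernstein n k x"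
    by (rule mult_right_mono) (use assms in \<open>auto intro: Bernstein_nonneg\<close>)
  then show ?thesis
    unfolding Bernstein_Suc_index[symmetric] using pos by (simp add: mult_le_cancel_left_pos)
qed

section \<open>Changing the number of trials at fixed mean\<close>

text \<open>
  The probability \<open>P(S \<le> m)\<close> for the sum \<open>S\<close> of a \<open>Bin(n, x)\<close> variable and an independent Bernoulli
  variable with parameter \<open>\<epsilon>\<close>.
\<close>

definition mixed_cdf :: "nat \<Rightarrow> nat \<Rightarrow> real \<Rightarrow> real \<Rightarrow> real" where
  "mixed_cdf n m x \<epsilon> = binomial_cdf n m x - \<epsilon> * Bernstein n m x"

lemma mixed_cdf_0: "mixed_cdf n m x 0 = binomial_cdf n m x"
  by (simp add: mixed_cdf_def)

lemma mixed_cdf_same: "mixed_cdf n m x x = binomial_cdf (Suc n) m x"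
  by (simp add: mixed_cdf_def binomial_cdf_Suc)

text \<open>Here \<open>c\<close> stands for the mass at \<open>m - 1\<close>, set to 0 for
  \<open>m = 0\<close>. With \<open>Suc n\<close> equal trials, the factor \<open>Suc n\<close> from
  differentiating in \<open>x\<close> cancels against the slope \<open>- 1 / Suc n\<close> of
  \<open>x\<close> in \<open>\<epsilon>\<close>.\<close>

lemma has_field_derivative_mixed_cdf:
  fixes \<mu> \<epsilon> :: real and n m :: nat
  defines "x \<equiv> (\<mu> - \<epsilon>) / real (Suc n)"
  defines "c \<equiv> (case m of 0 \<Rightarrow> 0 | Suc k \<Rightarrow> Bernstein n k x)"
  shows "((\<lambda>\<epsilon>. mixed_cdf (Suc n) m ((\<mu> - \<epsilon>) / real (Suc n)) \<epsilon>) has_real_derivative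
      (x - \<epsilon>) * (Bernstein n m x - c)) (at \<epsilon>)"
proof -
  define b where "b = Bernstein n m x"
  have x: "((\<lambda>\<epsilon>. (\<mu> - \<epsilon>) / real (Suc n)) has_real_derivative (- 1 / real (Suc n))) (at \<epsilon>)"
    by (rule DERIV_cdivide) (auto intro!: derivative_eq_intros)
  have rec: "Bernstein (Suc n) m x = x * c + (1 - x) * b"
    unfolding c_def b_def by (cases m) (simp_all add: Bernstein_Suc_Suc, simp add: Bernstein_def)
  have deriv: "(Bernstein (Suc n) m has_real_derivative real (Suc n) * (c - b)) (at x)"
    unfolding c_def b_def
    using has_field_derivative_Bernstein_0 has_field_derivative_Bernstein_Suc
    by (cases m) (simp_all del: of_nat_Suc)
  have cdf: "((\<lambda>\<epsilon>. binomial_cdf (Suc n) m ((\<mu> - \<epsilon>) / real (Suc n))) has_real_derivative b) (at \<epsilon>)"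
    using DERIV_chain2[OF has_field_derivative_binomial_cdf x, of n m]
    by (simp add: b_def x_def del: of_nat_Suc)
  have bern: "((\<lambda>\<epsilon>. Bernstein (Suc n) m ((\<mu> - \<epsilon>) / real (Suc n))) has_real_derivative b - c) (at \<epsilon>)"
    using DERIV_chain2[OF deriv[unfolded x_def] x] by (simp del: of_nat_Suc)
  have "((\<lambda>\<epsilon>. mixed_cdf (Suc n) m ((\<mu> - \<epsilon>) / real (Suc n)) \<epsilon>) has_real_derivative
      b - (\<epsilon> * (b - c) + Bernstein (Suc n) m x)) (at \<epsilon>)"
    unfolding mixed_cdf_def x_def
    by (rule derivative_eq_intros cdf bern refl)+ simp
  \<comment> \<open>Expanding the remaining mass as \<open>x * c + (1 - x) * b\<close> turns the
    derivative into a product whose two factors have separately controlled signs.\<close>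
  also have "b - (\<epsilon> * (b - c) + Bernstein (Suc n) m x) = (x - \<epsilon>) * (b - c)"
    using rec by (simp add: algebra_simps)
  finally show ?thesis unfolding b_def .
qed

text \<open>The upper limit for \<open>\<epsilon>\<close> is the value at which it meets
  \<open>x = (\<mu> - \<epsilon>) / Suc n\<close>; both the limit and
  \<open>\<epsilon> \<le> x\<close> amount to
  \<open>\<epsilon> * Suc n + \<epsilon> \<le> \<mu>\<close>.\<close>

lemma mixed_probability_bounds:
  fixes \<mu> \<epsilon> :: real
  assumes "0 < \<mu>" "\<mu> < real (Suc n)" "0 \<le> \<epsilon>" "\<epsilon> \<le> \<mu> / real (Suc (Suc n))"
  shows "0 \<le> (\<mu> - \<epsilon>) / real (Suc n)" "(\<mu> - \<epsilon>) / real (Suc n) < 1"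
    "\<epsilon> \<le> (\<mu> - \<epsilon>) / real (Suc n)" "real (Suc n) * ((\<mu> - \<epsilon>) / real (Suc n)) = \<mu> - \<epsilon>" "\<epsilon> < 1"
proof -
  define N where "N = real (Suc n)"
  have N: "N > 0" by (simp add: N_def)
  have "real (Suc (Suc n)) = N + 1" by (simp add: N_def)
  then have "\<epsilon> \<le> \<mu> / (N + 1)" using assms(4) by (simp only:)
  then have "\<epsilon> * (N + 1) \<le> \<mu>" using N by (simp only: pos_le_divide_eq)
  then have *: "\<epsilon> * N + \<epsilon> \<le> \<mu>" by (simp only: distrib_left mult_1_right)
  have **: "0 \<le> \<epsilon> * N" using N assms(3) by simp
  show "0 \<le> (\<mu> - \<epsilon>) / real (Suc n)"
    unfolding N_def[symmetric] using N * ** by simp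
  show "(\<mu> - \<epsilon>) / real (Suc n) < 1"
    using N assms(2,3) unfolding N_def[symmetric] by (simp only: pos_divide_less_eq)
  show "\<epsilon> \<le> (\<mu> - \<epsilon>) / real (Suc n)"
    using N * unfolding N_def[symmetric] by (simp only: pos_le_divide_eq)
  show "real (Suc n) * ((\<mu> - \<epsilon>) / real (Suc n)) = \<mu> - \<epsilon>" by simp
  have "\<epsilon> * N < 1 * N" using * assms(2,3) unfolding N_def[symmetric] by linarith
  then show "\<epsilon> < 1" using N by (simp only: mult_less_cancel_right_pos)
qed

text \<open>At this \<open>\<epsilon>\<close> the extra trial has the same success probability as
  the other \<open>Suc n\<close>.\<close>

lemma mixed_cdf_endpoint:
  "mixed_cdf (Suc n) m ((\<mu> - \<mu> / real (Suc (Suc n))) / real (Suc n)) (\<mu> / real (Suc (Suc n))) =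
    binomial_cdf (Suc (Suc n)) m (\<mu> / real (Suc (Suc n)))"
proof -
  have fixed_mean: "(\<mu> - \<mu> / (N + 1)) / N = \<mu> / (N + 1)" if "N > 0" for N :: real
    using that by (simp add: divide_simps) (simp add: algebra_simps)
  have "(\<mu> - \<mu> / real (Suc (Suc n))) / real (Suc n) = \<mu> / real (Suc (Suc n))"
    using fixed_mean[of "real (Suc n)"] by (simp add: add.commute)
  then show ?thesis by (simp only: mixed_cdf_same)
qed

lemma binomial_cdf_fixed_mean_decreasing:
  assumes "0 < \<mu>" "\<mu> < real (Suc n)" "\<mu> \<le> real m"
  shows "binomial_cdf (Suc (Suc n)) m (\<mu> / real (Suc (Suc n))) \<le>
    binomial_cdf (Suc n) m (\<mu> / real (Suc n))"
proof -
  let ?G = "\<lambda>\<epsilon>. mixed_cdf (Suc n) m ((\<mu> - \<epsilon>) / real (Suc n)) \<epsilon>"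
  obtain k where m: "m = Suc k" using assms by (cases m) auto
  have "?G (\<mu> / real (Suc (Suc n))) \<le> ?G 0"
  proof (rule DERIV_nonpos_imp_nonincreasing[where f = ?G])
    show "0 \<le> \<mu> / real (Suc (Suc n))" using assms by simp
    fix \<epsilon> :: real
    assume \<epsilon>: "0 \<le> \<epsilon>" "\<epsilon> \<le> \<mu> / real (Suc (Suc n))"
    define x where "x = (\<mu> - \<epsilon>) / real (Suc n)"
    note x = mixed_probability_bounds[OF assms(1,2) \<epsilon>, folded x_def]
    \<comment> \<open>Since \<open>Suc n * x = \<mu> - \<epsilon>\<close>, the unimodality condition
      reads \<open>\<mu> - \<epsilon> \<le> m\<close>, which follows from
      \<open>\<mu> \<le> m\<close>.\<close>
    have "Bernstein n (Suc k) x \<le> Bernstein n k x"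
      using x \<epsilon> assms by (intro Bernstein_Suc_index_le) (auto simp: m)
    then have "(x - \<epsilon>) * (Bernstein n m x - (case m of 0 \<Rightarrow> 0 | Suc k \<Rightarrow> Bernstein n k x)) \<le> 0"
      using x by (simp add: m mult_nonneg_nonpos)
    then show "\<exists>y. (?G has_real_derivative y) (at \<epsilon>) \<and> y \<le> 0"
      using has_field_derivative_mixed_cdf[of n m \<mu> \<epsilon>, folded x_def] by blast
  qed
  then show ?thesis unfolding mixed_cdf_endpoint by (simp add: mixed_cdf_0)
qed

lemma binomial_cdf_fixed_mean_increasing:
  assumes "\<mu> < real (Suc n)" "real (Suc m) \<le> \<mu>"
  shows "binomial_cdf (Suc n) m (\<mu> / real (Suc n)) \<le>
    binomial_cdf (Suc (Suc n)) m (\<mu> / real (Suc (Suc n)))"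
proof -
  let ?G = "\<lambda>\<epsilon>. mixed_cdf (Suc n) m ((\<mu> - \<epsilon>) / real (Suc n)) \<epsilon>"
  have \<mu>: "0 < \<mu>" using assms by simp
  have "?G 0 \<le> ?G (\<mu> / real (Suc (Suc n)))"
  proof (rule DERIV_nonneg_imp_nondecreasing[where f = ?G])
    show "0 \<le> \<mu> / real (Suc (Suc n))" using \<mu> by simp
    fix \<epsilon> :: real
    assume \<epsilon>: "0 \<le> \<epsilon>" "\<epsilon> \<le> \<mu> / real (Suc (Suc n))"
    define x where "x = (\<mu> - \<epsilon>) / real (Suc n)"
    note x = mixed_probability_bounds[OF \<mu> assms(1) \<epsilon>, folded x_def]
    have "(case m of 0 \<Rightarrow> 0 | Suc k \<Rightarrow> Bernstein n k x) \<le> Bernstein n m x"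
    proof (cases m)
      case 0
      then show ?thesis using x by (auto intro: Bernstein_nonneg)
    next
      case (Suc k)
      \<comment> \<open>Now the condition reads \<open>m \<le> \<mu> - \<epsilon>\<close>. The gap
        of one in \<open>m + 1 \<le> \<mu>\<close> absorbs \<open>\<epsilon> < 1\<close>.\<close>
      have "Bernstein n k x \<le> Bernstein n (Suc k) x"
        using x \<epsilon> assms Suc by (intro Bernstein_Suc_index_ge) auto
      then show ?thesis by (simp add: Suc)
    qed
    then have "0 \<le> (x - \<epsilon>) * (Bernstein n m x - (case m of 0 \<Rightarrow> 0 | Suc k \<Rightarrow> Bernstein n k x))"
      using x by simp
    then show "\<exists>y. (?G has_real_derivative y) (at \<epsilon>) \<and> 0 \<le> y"
      using has_field_derivative_mixed_cdf[of n m \<mu> \<epsilon>, folded x_def] by blast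
  qed
  then show ?thesis unfolding mixed_cdf_endpoint by (simp add: mixed_cdf_0)
qed

section \<open>The Poisson limit and the comparison with it\<close>

text \<open>Induction on \<open>k\<close>: the ratio of consecutive binomial masses tends to
  \<open>\<mu> / (k + 1)\<close>, the ratio of consecutive Poisson masses.\<close>

lemma tendsto_Bernstein_poisson:
  assumes "0 \<le> \<mu>"
  shows "(\<lambda>n. Bernstein n k (\<mu> / real n)) \<longlonglongrightarrow> \<mu> ^ k / fact k * exp (- \<mu>)"
proof (induction k)
  case 0
  show ?case using tendsto_exp_limit_sequentially[of "- \<mu>"] by (simp add: Bernstein_def)
next
  case (Suc k)
  have "(\<lambda>n. (real n - real k) * (\<mu> / real n) / ((1 + real k) * (1 - \<mu> / real n)))
          \<longlonglongrightarrow> \<mu> / (1 + real k)"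
    unfolding divide_inverse[of \<mu> "1 + real k"] by real_asymp
  from tendsto_mult[OF this Suc]
  have *: "(\<lambda>n. (real n - real k) * (\<mu> / real n) / ((1 + real k) * (1 - \<mu> / real n)) *
             Bernstein n k (\<mu> / real n)) \<longlonglongrightarrow> \<mu> ^ Suc k / fact (Suc k) * exp (- \<mu>)"
    by (simp add: mult_ac)
  show ?case
  proof (rule Lim_transform_eventually[OF *])
    show "\<forall>\<^sub>F n in sequentially. (real n - real k) * (\<mu> / real n) / ((1 + real k) * (1 - \<mu> / real n)) *
             Bernstein n k (\<mu> / real n) = Bernstein n (Suc k) (\<mu> / real n)"
      \<comment> \<open>Beyond this bound \<open>\<mu> / n < 1\<close>, so the denominator of the
        ratio is nonzero.\<close>
      using eventually_gt_at_top[of "nat \<lceil>\<mu>\<rceil>"]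
    proof eventually_elim
      case (elim n)
      then have "\<mu> < real n" by linarith
      then have "1 - \<mu> / real n \<noteq> 0" using assms by (simp add: field_simps)
      then have "(1 + real k) * (1 - \<mu> / real n) \<noteq> 0" by simp
      then show ?case
        unfolding times_divide_eq_left Bernstein_Suc_index[symmetric]
        by (rule nonzero_mult_div_cancel_left)
    qed
  qed
qed

lemma prob_binomial_pmf_atMost:
  assumes "0 \<le> p" "p \<le> 1"
  shows "measure_pmf.prob (binomial_pmf n p) {..m} = binomial_cdf n m p"
  using assms by (simp add: measure_measure_pmf_finite binomial_cdf_def Bernstein_def)

lemma tendsto_binomial_cdf_poisson:
  assumes "0 < \<mu>"
  shows "(\<lambda>n. binomial_cdf n m (\<mu> / real n)) \<longlonglongrightarrow> measure_pmf.prob (poisson_pmf \<mu>) {..m}"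
  unfolding binomial_cdf_def measure_measure_pmf_finite[OF finite_atMost] pmf_poisson[OF assms]
  using assms by (intro tendsto_sum tendsto_Bernstein_poisson) simp

lemma tendsto_binomial_cdf_poisson_shifted:
  assumes "0 < \<mu>"
  shows "(\<lambda>j. binomial_cdf (Suc n + j) m (\<mu> / real (Suc n + j))) \<longlonglongrightarrow>
    measure_pmf.prob (poisson_pmf \<mu>) {..m}"
  using LIMSEQ_ignore_initial_segment[OF tendsto_binomial_cdf_poisson[OF assms, of m], of "Suc n"]
  by (simp only: add.commute)

text \<open>Along \<open>n, n + 1, ...\<close> with the mean held at \<open>\<mu>\<close> the values
  decrease, so the first one bounds their limit from above.\<close>

lemma poisson_cdf_le_binomial_cdf:
  assumes "n \<ge> 1" "0 < \<mu>" "\<mu> < real n" "\<mu> \<le> real m"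
  shows "measure_pmf.prob (poisson_pmf \<mu>) {..m} \<le> binomial_cdf n m (\<mu> / real n)"
proof -
  obtain N where n: "n = Suc N" using assms(1) by (cases n) auto
  have "decseq (\<lambda>j. binomial_cdf (Suc N + j) m (\<mu> / real (Suc N + j)))"
  proof (rule decseq_SucI)
    fix j
    show "binomial_cdf (Suc N + Suc j) m (\<mu> / real (Suc N + Suc j)) \<le>
        binomial_cdf (Suc N + j) m (\<mu> / real (Suc N + j))"
      using binomial_cdf_fixed_mean_decreasing[of \<mu> "N + j" m] assms by (simp add: n)
  qed
  from decseq_ge[OF this tendsto_binomial_cdf_poisson_shifted, of 0] show ?thesis
    using assms by (simp add: n)
qed

lemma binomial_cdf_le_poisson_cdf:
  assumes "n \<ge> 1" "\<mu> < real n" "real (Suc m) \<le> \<mu>"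
  shows "binomial_cdf n m (\<mu> / real n) \<le> measure_pmf.prob (poisson_pmf \<mu>) {..m}"
proof -
  obtain N where n: "n = Suc N" using assms(1) by (cases n) auto
  have "incseq (\<lambda>j. binomial_cdf (Suc N + j) m (\<mu> / real (Suc N + j)))"
  proof (rule incseq_SucI)
    fix j
    show "binomial_cdf (Suc N + j) m (\<mu> / real (Suc N + j)) \<le>
        binomial_cdf (Suc N + Suc j) m (\<mu> / real (Suc N + Suc j))"
      using binomial_cdf_fixed_mean_increasing[of \<mu> "N + j" m] assms by (simp add: n)
  qed
  from incseq_le[OF this tendsto_binomial_cdf_poisson_shifted, of 0] show ?thesis
    using assms by (simp add: n)
qed

section \<open>From distribution functions to levels of tests\<close>

lemma prob_pmf_atLeast_Suc:
  fixes M :: "nat pmf"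
  shows "measure_pmf.prob M {k. k \<ge> Suc m} = 1 - measure_pmf.prob M {..m}"
proof -
  have "{k. k \<ge> Suc m} = UNIV - {..m}" by auto
  then show ?thesis using measure_pmf.prob_compl[of "{..m}" M] by simp
qed

lemma prob_pmf_interval:
  fixes M :: "nat pmf"
  assumes "m1 \<le> m2"
  shows "measure_pmf.prob M {k. Suc m1 \<le> k \<and> k \<le> m2} =
    measure_pmf.prob M {..m2} - measure_pmf.prob M {..m1}"
proof -
  have "{k. Suc m1 \<le> k \<and> k \<le> m2} = {..m2} - {..m1}" by auto
  then show ?thesis using assms by (simp add: measure_pmf.finite_measure_Diff)
qed

lemma expectation_right_sided_test:
  "measure_pmf.expectation M (right_sided_test m) = measure_pmf.prob M {k. k \<ge> m}"
  by (simp add: right_sided_test_def[abs_def])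

lemma expectation_left_sided_test:
  "measure_pmf.expectation M (left_sided_test m) = measure_pmf.prob M {k. k \<le> m}"
  by (simp add: left_sided_test_def[abs_def])

lemma expectation_two_sided_test:
  "measure_pmf.expectation M (two_sided_test m1 m2) =
    1 - measure_pmf.prob M {k. m1 \<le> k \<and> k \<le> m2}"
  unfolding two_sided_test_def[abs_def]
  by (subst Bochner_Integration.integral_diff) (auto simp: measure_pmf.emeasure_eq_measure)

text \<open>Rejection is the complement of \<open>X \<le> m - 1\<close>, and the hypothesis on
  \<open>m\<close> says that \<open>m - 1\<close> is at least the mean. Parameters below
  \<open>p0\<close> reduce to \<open>p0\<close> because the distribution function is antitone in
  \<open>p\<close>. The set \<open>H0\<close> is left general to serve both the simple and the
  one-sided null hypothesis.\<close>

lemma right_sided_test_level: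
  assumes "n \<ge> 1" "0 < p0" "p0 < 1" "real n * p0 + 1 \<le> real m" "H0 \<subseteq> {0..p0}"
  shows "binomial_test_of_level n H0 (right_sided_test m)
    (measure_pmf.prob (poisson_pmf (real n * p0)) {k. k \<ge> m})"
  unfolding binomial_test_of_level_def
proof
  fix p assume "p \<in> H0"
  then have p: "0 \<le> p" "p \<le> p0" using assms by auto
  have "0 < real n * p0" using assms by simp
  then obtain k where m: "m = Suc k" using assms(4) by (cases m) auto
  have "measure_pmf.prob (poisson_pmf (real n * p0)) {..k} \<le> binomial_cdf n k p0"
    using poisson_cdf_le_binomial_cdf[of n "real n * p0" k] assms by (simp add: m)
  also have "\<dots> \<le> binomial_cdf n k p"
    using p assms by (intro binomial_cdf_antimono) auto
  finally show "measure_pmf.expectation (binomial_pmf n p) (right_sided_test m) \<le>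
      measure_pmf.prob (poisson_pmf (real n * p0)) {k. k \<ge> m}"
    using p assms
    unfolding expectation_right_sided_test m prob_pmf_atLeast_Suc
    by (simp add: prob_binomial_pmf_atMost)
qed

lemma left_sided_test_level:
  assumes "n \<ge> 1" "0 < p0" "p0 < 1" "real m \<le> real n * p0 - 1" "H0 \<subseteq> {p0..1}"
  shows "binomial_test_of_level n H0 (left_sided_test m)
    (measure_pmf.prob (poisson_pmf (real n * p0)) {k. k \<le> m})"
  unfolding binomial_test_of_level_def
proof
  fix p assume "p \<in> H0"
  then have p: "p0 \<le> p" "p \<le> 1" using assms by auto
  have "binomial_cdf n m p \<le> binomial_cdf n m p0"
    using p assms by (intro binomial_cdf_antimono) auto
  also have "\<dots> \<le> measure_pmf.prob (poisson_pmf (real n * p0)) {..m}"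
    using binomial_cdf_le_poisson_cdf[of n "real n * p0" m] assms by simp
  finally show "measure_pmf.expectation (binomial_pmf n p) (left_sided_test m) \<le>
      measure_pmf.prob (poisson_pmf (real n * p0)) {k. k \<le> m}"
    using p assms
    unfolding expectation_left_sided_test atMost_def[symmetric]
    by (simp add: prob_binomial_pmf_atMost)
qed

text \<open>The acceptance probability is the distribution function at \<open>m2\<close> minus that
  at \<open>m1 - 1\<close>. Passing from Poisson to binomial raises the first, as \<open>m2\<close>
  is at least the mean, and lowers the second, as \<open>m1 - 1\<close> is at most the mean minus
  one.\<close>

lemma two_sided_test_level:
  assumes "n \<ge> 1" "0 < p0" "p0 < 1" "m1 \<ge> 1" "real m1 \<le> real n * p0" "real n * p0 \<le> real m2"
  shows "binomial_test_of_level n {p0} (two_sided_test m1 m2)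
    (1 - measure_pmf.prob (poisson_pmf (real n * p0)) {k. m1 \<le> k \<and> k \<le> m2})"
proof -
  obtain k where k: "m1 = Suc k" using assms(4) by (cases m1) auto
  have le: "k \<le> m2" using assms k by linarith
  have "binomial_cdf n k p0 \<le> measure_pmf.prob (poisson_pmf (real n * p0)) {..k}"
    using binomial_cdf_le_poisson_cdf[of n "real n * p0" k] assms by (simp add: k)
  moreover have "measure_pmf.prob (poisson_pmf (real n * p0)) {..m2} \<le> binomial_cdf n m2 p0"
    using poisson_cdf_le_binomial_cdf[of n "real n * p0" m2] assms by simp
  ultimately show ?thesis
    using assms
    unfolding binomial_test_of_level_def expectation_two_sided_test k prob_pmf_interval[OF le]
    by (simp add: prob_binomial_pmf_atMost)
qed

theorem corollary9:
  fixes n :: nat and p0 :: real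
  assumes "n \<ge> 1" and "0 < p0" and "p0 < 1"
  shows
    "(\<forall>m::nat. m \<ge> 1 \<and> real m \<ge> real n * p0 + 1 \<and> n \<ge> m \<longrightarrow>
        (let \<alpha> = measure_pmf.prob (poisson_pmf (real n * p0)) {k. k \<ge> m} in
           binomial_test_of_level n {p0} (right_sided_test m) \<alpha> \<and>
           binomial_test_of_level n {p. 0 < p \<and> p < 1 \<and> p \<le> p0} (right_sided_test m) \<alpha>)) \<and>
     (\<forall>m::nat. m \<ge> 1 \<and> real m \<le> real n * p0 - 1 \<longrightarrow>
        (let \<alpha> = measure_pmf.prob (poisson_pmf (real n * p0)) {k. k \<le> m} in
           binomial_test_of_level n {p0} (left_sided_test m) \<alpha> \<and>
           binomial_test_of_level n {p. 0 < p \<and> p < 1 \<and> p \<ge> p0} (left_sided_test m) \<alpha>)) \<and>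
     (\<forall>m1 m2::nat. m1 \<ge> 1 \<and> m2 \<ge> 1 \<and> real m1 \<le> real n * p0 \<and> real n * p0 \<le> real m2 \<and>
          n \<ge> m2 + 1 \<longrightarrow>
        (let \<alpha> = 1 - measure_pmf.prob (poisson_pmf (real n * p0)) {k. m1 \<le> k \<and> k \<le> m2} in
           binomial_test_of_level n {p0} (two_sided_test m1 m2) \<alpha>))"
  unfolding Let_def
proof (intro conjI allI impI; elim conjE)
  fix m
  assume m: "real n * p0 + 1 \<le> real m"
  show "binomial_test_of_level n {p0} (right_sided_test m)
      (measure_pmf.prob (poisson_pmf (real n * p0)) {k. k \<ge> m})"
    using assms m by (intro right_sided_test_level) auto
  show "binomial_test_of_level n {p. 0 < p \<and> p < 1 \<and> p \<le> p0} (right_sided_test m)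
      (measure_pmf.prob (poisson_pmf (real n * p0)) {k. k \<ge> m})"
    using assms m by (intro right_sided_test_level) auto
next
  fix m
  assume m: "real m \<le> real n * p0 - 1"
  show "binomial_test_of_level n {p0} (left_sided_test m)
      (measure_pmf.prob (poisson_pmf (real n * p0)) {k. k \<le> m})"
    using assms m by (intro left_sided_test_level) auto
  show "binomial_test_of_level n {p. 0 < p \<and> p < 1 \<and> p \<ge> p0} (left_sided_test m)
      (measure_pmf.prob (poisson_pmf (real n * p0)) {k. k \<le> m})"
    using assms m by (intro left_sided_test_level) auto
next
  fix m1 m2 :: nat
  assume "1 \<le> m1" "real m1 \<le> real n * p0" "real n * p0 \<le> real m2"
  then show "binomial_test_of_level n {p0} (two_sided_test m1 m2)
      (1 - measure_pmf.prob (poisson_pmf (real n * p0)) {k. m1 \<le> k \<and> k \<le> m2})"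
    by (rule two_sided_test_level[OF assms])
qed

end
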